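(* Let $f\colon M\to M$ be a homeomorphism of a compact metric space $(M,d)$. If $M$ is locally connected, $f$ is cw-expansive and $f$ has a shadowing map, then $f$ is expansive.
   Context: $\tilde M=M^{\mathbb Z}$ has the product topology; $\sigma\colon\tilde M\to\tilde M$ is the shift, $(\sigma(x))_i=x_{i+1}$; for $p\in M$, $\mathrm{orb}_f(p)\in\tilde M$ is given by $(\mathrm{orb}_f(p))_i=f^i(p)$. For $\delta\ge 0$, $\tilde M(f,\delta)=\{x\in\tilde M: d(x_{i+1},f(x_i))\le\delta\ \forall i\in\mathbb Z\}$. A pseudo-orbit map for $f$ is a continuous map $\mathrm{Sh}_f\colon\tilde M(f,\delta)\to M$ (for some $\delta>0$) with $\mathrm{Sh}_f(\mathrm{orb}_f(p))=p$ for all $p\in M$. It is a shadowing map if moreover for all $\epsilon>0$ there is $\gamma\in(0,\delta]$ such that $d(f^i(\mathrm{Sh}_f(x)),\mathrm{Sh}_f(\sigma^i(x)))\le\epsilon$ for all $x\in\tilde M(f,\gamma)$ and $i\in\mathbb Z$. A continuum is a closed connected subset of $M$. $f$ is cw-expansive if there is $\xi>0$ such that if $C\subset M$ is a continuum and $\operatorname{diam}(f^i(C))\le\xi$ for all $i\in\mathbb Z$ then $C$ is a singleton. $f$ is expansive if there is $\xi>0$ such that $p\neq q$ implies $d(f^i(p),f^i(q))>\xi$ for some $i\in\mathbb Z$. *)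

theory Defs
  imports "HOL-Analysis.Analysis"
begin

text \<open>
  The space \<open>M\<close> is the universe of a type of class \<^class>\<open>metric_space\<close>; compactness is assumed where it
  is needed. The space of two-sided sequences is the type \<^typ>\<open>int \<Rightarrow> 'a\<close>, whose
  \<^class>\<open>topological_space\<close> instance is the product topology.
\<close>

text \<open>Integer iterates; for negative exponents this is only meaningful if \<open>f\<close> is bijective.\<close>

definition iter :: "('b \<Rightarrow> 'b) \<Rightarrow> int \<Rightarrow> 'b \<Rightarrow> 'b" where
  "iter f i = (if 0 \<le> i then f ^^ nat i else (inv f) ^^ nat (- i))"

definition shift :: "(int \<Rightarrow> 'b) \<Rightarrow> (int \<Rightarrow> 'b)" where
  "shift x = (\<lambda>i. x (i + 1))"

definition orb :: "('b \<Rightarrow> 'b) \<Rightarrow> 'b \<Rightarrow> (int \<Rightarrow> 'b)" where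
  "orb f p = (\<lambda>i. iter f i p)"

definition pseudo_orbits :: "('a::metric_space \<Rightarrow> 'a) \<Rightarrow> real \<Rightarrow> (int \<Rightarrow> 'a) set" where
  "pseudo_orbits f \<delta> = {x. \<forall>i. dist (x (i + 1)) (f (x i)) \<le> \<delta>}"

text \<open>
  A map defined on \<^term>\<open>pseudo_orbits f \<delta>\<close> is represented by a total function, of which only the
  restriction to that set matters.
\<close>

definition pseudo_orbit_map ::
    "('a::metric_space \<Rightarrow> 'a) \<Rightarrow> real \<Rightarrow> ((int \<Rightarrow> 'a) \<Rightarrow> 'a) \<Rightarrow> bool" where
  "pseudo_orbit_map f \<delta> Sh \<longleftrightarrow>
     \<delta> > 0 \<and> continuous_on (pseudo_orbits f \<delta>) Sh \<and> (\<forall>p. Sh (orb f p) = p)"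

definition shadowing_map ::
    "('a::metric_space \<Rightarrow> 'a) \<Rightarrow> real \<Rightarrow> ((int \<Rightarrow> 'a) \<Rightarrow> 'a) \<Rightarrow> bool" where
  "shadowing_map f \<delta> Sh \<longleftrightarrow>
     pseudo_orbit_map f \<delta> Sh \<and>
     (\<forall>\<epsilon>>0. \<exists>\<gamma>. 0 < \<gamma> \<and> \<gamma> \<le> \<delta> \<and>
        (\<forall>x\<in>pseudo_orbits f \<gamma>. \<forall>i. dist (iter f i (Sh x)) (Sh (iter shift i x)) \<le> \<epsilon>))"

text \<open>
  Continua are nonempty. In the library the empty set is connected, and without this condition no map
  would satisfy the definition of cw-expansivity.
\<close>

definition continuum :: "'a::topological_space set \<Rightarrow> bool" where
  "continuum C \<longleftrightarrow> C \<noteq> {} \<and> closed C \<and> connected C"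

definition cw_expansive :: "('a::metric_space \<Rightarrow> 'a) \<Rightarrow> bool" where
  "cw_expansive f \<longleftrightarrow>
     (\<exists>\<xi>>0. \<forall>C. continuum C \<and> (\<forall>i. diameter (iter f i ` C) \<le> \<xi>) \<longrightarrow> is_singleton C)"

definition expansive :: "('a::metric_space \<Rightarrow> 'a) \<Rightarrow> bool" where
  "expansive f \<longleftrightarrow>
     (\<exists>\<xi>>0. \<forall>p q. p \<noteq> q \<longrightarrow> (\<exists>i. dist (iter f i p) (iter f i q) > \<xi>))"

end

theory Submission
  imports Defs
begin

text \<open>
  Suppose the orbits of \<open>p\<close> and \<open>q\<close> stay uniformly very close. A compact locally connected space is
  uniformly so, hence for each \<open>i\<close> there is a small connected set \<open>C i\<close> containing both \<open>f\<^sup>i p\<close> and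
  \<open>f\<^sup>i q\<close> (lemma \<open>uniformly_locally_connected\<close>). The box \<open>K = \<Pi> i. C i\<close> is connected in the product
  topology, contains the orbits of \<open>p\<close> and \<open>q\<close>, and consists of pseudo-orbits with small error,
  because each of its members follows the orbit of \<open>p\<close> closely (lemma
  \<open>pseudo_orbit_if_near_orbit\<close>). Its image under the shadowing map is therefore a connected set
  containing \<open>p\<close> and \<open>q\<close>.

  This image stays small under all iterates. For \<open>x\<close> in \<open>K\<close> the point \<open>f\<^sup>i (Sh x)\<close> is close to
  \<open>Sh (\<sigma>\<^sup>i x)\<close>, by the shadowing property, and \<open>\<sigma>\<^sup>i x\<close> follows the orbit of \<open>f\<^sup>i p\<close> closely. As \<open>Sh\<close> is
  uniformly continuous and sends that orbit to \<open>f\<^sup>i p\<close>, the point \<open>Sh (\<sigma>\<^sup>i x)\<close> is close to \<open>f\<^sup>i p\<close>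
  (lemma \<open>pseudo_orbit_map_near\<close>). So cw-expansivity applies to the closure of \<open>Sh ` K\<close> and shows
  that it is a single point, whence \<open>p = q\<close>.
\<close>

section \<open>Integer iterates\<close>

lemma iter_0 [simp]: "iter f 0 x = x"
  by (simp add: iter_def)

lemma iter_Suc:
  assumes "bij f"
  shows "iter f (i + 1) x = f (iter f i x)"
proof (cases "0 \<le> i")
  case True
  then show ?thesis
    by (simp add: iter_def nat_add_distrib)
next
  case False
  \<comment> \<open>For negative \<open>i\<close> the exponent of \<open>inv f\<close> drops by one, which \<open>f\<close> achieves by cancelling the
    outermost \<open>inv f\<close>.\<close>
  define n where "n = nat (- (i + 1))"
  have n: "nat (- i) = Suc n"
    using False by (simp add: n_def)
  have "f (iter f i x) = ((inv f) ^^ n) x"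
    using False assms n by (simp add: iter_def bij_is_surj surj_f_inv_f)
  moreover have "iter f (i + 1) x = ((inv f) ^^ n) x"
    using False by (cases "i = -1") (auto simp: iter_def n_def)
  ultimately show ?thesis by simp
qed

lemma iter_add:
  assumes "bij f"
  shows "iter f (j + i) x = iter f j (iter f i x)"
proof (induction j rule: int_induct [where k = 0])
  case base
  show ?case by simp
next
  case (step1 j)
  then show ?case
    using iter_Suc[OF assms, of "j + i" x] iter_Suc[OF assms, of j] by (simp add: algebra_simps)
next
  case (step2 j)
  have "f (iter f (j - 1 + i) x) = f (iter f (j - 1) (iter f i x))"
    using step2 iter_Suc[OF assms, of "j - 1 + i" x] iter_Suc[OF assms, of "j - 1"]
    by (simp add: algebra_simps)
  then show ?case
    using assms by (metis bij_is_inj injD)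
qed

lemma bij_shift: "bij (shift :: (int \<Rightarrow> 'b) \<Rightarrow> _)"
  by (rule bij_betw_byWitness[where f' = "\<lambda>x i. x (i - 1)"]) (auto simp: shift_def)

lemma iter_shift: "iter shift i x j = x (j + i)"
proof (induction i arbitrary: j rule: int_induct [where k = 0])
  case base
  show ?case by simp
next
  case (step1 i)
  have "iter shift (i + 1) x j = iter shift i x (j + 1)"
    by (simp add: iter_Suc[OF bij_shift]) (simp add: shift_def)
  then show ?case using step1 by (simp add: algebra_simps)
next
  case (step2 i)
  have "iter shift i x (j - 1) = iter shift (i - 1) x j"
    using iter_Suc[OF bij_shift, of "i - 1" x] by (simp add: shift_def)
  then show ?case using step2.IH[of "j - 1"] by (simp add: algebra_simps)
qed

lemma iter_shift_pseudo_orbits: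
  "x \<in> pseudo_orbits f \<delta> \<Longrightarrow> iter shift i x \<in> pseudo_orbits f \<delta>"
  unfolding pseudo_orbits_def iter_shift
  by (simp add: add.assoc add.commute[of 1 i]) (simp flip: add.assoc)

lemma continuous_on_funpow:
  fixes f :: "'a::topological_space \<Rightarrow> 'a"
  assumes "continuous_on UNIV f"
  shows "continuous_on UNIV (f ^^ n)"
proof (induction n)
  case (Suc n)
  then show ?case
    using continuous_on_compose2[OF assms Suc.IH] by (simp add: comp_def)
qed (simp add: id_def)

lemma continuous_on_iter:
  assumes "homeomorphism UNIV UNIV f g"
  shows "continuous_on UNIV (iter f i)"
proof -
  have "inv f = g"
    using assms by (intro inv_equality) (auto simp: homeomorphism_def)
  then show ?thesis
    using assms unfolding iter_def homeomorphism_def by (auto intro: continuous_on_funpow)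
qed

section \<open>Compactness and connectedness\<close>

text \<open>
  The weights \<open>(1/2)\<^sup>n\<close> in the product metric sum to 2.
\<close>

lemma dist_fun_le_uniform:
  fixes x y :: "'i::countable \<Rightarrow> 'a::metric_space"
  assumes "\<And>i. dist (x i) (y i) \<le> e"
  shows "dist x y \<le> 2 * e"
proof -
  have "dist x y \<le> (\<Sum>n. (1/2)^n * e)"
    unfolding dist_fun_def
  proof (rule suminf_le)
    show "(1/2)^n * min (dist (x (from_nat n)) (y (from_nat n))) 1 \<le> (1/2)^n * e" for n
      using assms[of "from_nat n"] by (intro mult_left_mono) auto
    show "summable (\<lambda>n. (1/2)^n * min (dist (x (from_nat n)) (y (from_nat n))) 1)"
      by (rule summable_comparison_test'[of "\<lambda>n. (1/2)^n"]) (auto simp: summable_geometric_iff)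
    show "summable (\<lambda>n. (1/2)^n * e)"
      by (intro summable_mult2) (simp add: summable_geometric_iff)
  qed
  also have "\<dots> = (\<Sum>n. (1/2)^n) * e"
    by (rule suminf_mult2[symmetric]) (simp add: summable_geometric_iff)
  also have "\<dots> = 2 * e"
    using suminf_geometric[of "1/2::real"] by simp
  finally show ?thesis .
qed

lemma connected_Pi_UNIV:
  fixes C :: "'i \<Rightarrow> 'a::topological_space set"
  assumes "\<And>i. connected (C i)"
  shows "connected (Pi UNIV C)"
  using connectedin_PiE[of "\<lambda>_. euclidean" UNIV C] assms
  by (simp add: euclidean_product_topology PiE_UNIV_domain Pi_def)

lemma compact_UNIV_fun:
  assumes "compact (UNIV :: 'a::topological_space set)"
  shows "compact (UNIV :: ('i \<Rightarrow> 'a) set)"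
  using compactin_PiE[of "\<lambda>_. euclidean" UNIV "\<lambda>_::'i. UNIV :: 'a set"] assms
  by (simp add: euclidean_product_topology)

lemma closed_pseudo_orbits:
  fixes f :: "'a::metric_space \<Rightarrow> 'a"
  assumes "continuous_on UNIV f"
  shows "closed (pseudo_orbits f \<delta>)"
proof -
  have "continuous_on UNIV (\<lambda>x :: int \<Rightarrow> 'a. f (x i))" for i
    by (rule continuous_on_compose2[OF assms]) auto
  then show ?thesis
    unfolding pseudo_orbits_def
    by (intro closed_Collect_all closed_Collect_le continuous_intros) auto
qed

text \<open>
  A Lebesgue number of the cover by small connected neighbourhoods works at all points at once.
\<close>

lemma uniformly_locally_connected:
  assumes "compact (UNIV :: 'a::metric_space set)" "locally connected (UNIV :: 'a set)" "0 < e"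
  obtains d where "0 < d"
    "\<And>p q :: 'a. dist p q < d \<Longrightarrow> \<exists>C. connected C \<and> p \<in> C \<and> q \<in> C \<and> (\<forall>z\<in>C. dist z p \<le> e)"
proof -
  define \<G> where "\<G> = {U :: 'a set. open U \<and> (\<exists>V x. connected V \<and> U \<subseteq> V \<and> V \<subseteq> ball x (e/2))}"
  have "x \<in> \<Union>\<G>" for x :: 'a
  proof -
    have "openin (top_of_set UNIV) (ball x (e/2)) \<and> x \<in> ball x (e/2)"
      using \<open>0 < e\<close> by simp
    then obtain U V where "openin (top_of_set (UNIV :: 'a set)) U" "connected V" "x \<in> U" "U \<subseteq> V"
        "V \<subseteq> ball x (e/2)"
      using assms(2) unfolding locally_def by metis
    then show ?thesis
      unfolding \<G>_def by auto
  qed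
  then have "UNIV \<subseteq> \<Union>\<G>" by blast
  then obtain d where d: "0 < d" "\<And>x. \<exists>G\<in>\<G>. ball x d \<subseteq> G"
    using Heine_Borel_lemma[OF assms(1), of \<G>] unfolding \<G>_def by (metis (no_types, lifting) UNIV_I mem_Collect_eq)
  have "\<exists>C. connected C \<and> p \<in> C \<and> q \<in> C \<and> (\<forall>z\<in>C. dist z p \<le> e)" if pq: "dist p q < d" for p q :: 'a
  proof -
    obtain V x where V: "connected V" "ball p d \<subseteq> V" "V \<subseteq> ball x (e/2)"
      using d(2)[of p] unfolding \<G>_def by blast
    have "p \<in> V" "q \<in> V"
      using V(2) pq d(1) by auto
    moreover have "dist z p \<le> e" if "z \<in> V" for z
    proof -
      have "dist x z < e/2" "dist x p < e/2"
        using that \<open>p \<in> V\<close> V(3) by auto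
      then show ?thesis
        using dist_triangle3[of z p x] by linarith
    qed
    ultimately show ?thesis
      using V(1) by blast
  qed
  then show ?thesis
    using that d(1) by blast
qed

section \<open>Pseudo-orbits near an orbit\<close>

lemma pseudo_orbits_mono: "\<gamma> \<le> \<delta> \<Longrightarrow> pseudo_orbits f \<gamma> \<subseteq> pseudo_orbits f \<delta>"
  unfolding pseudo_orbits_def by (auto intro: order_trans)

lemma orb_in_pseudo_orbits:
  "bij f \<Longrightarrow> 0 \<le> \<delta> \<Longrightarrow> orb f p \<in> pseudo_orbits f \<delta>"
  by (simp add: pseudo_orbits_def orb_def iter_Suc)

lemma orb_iter: "bij f \<Longrightarrow> orb f (iter f i p) j = orb f p (j + i)"
  by (simp add: orb_def iter_add)

text \<open>
  If \<open>x\<close> follows the orbit of \<open>p\<close>, then \<open>x (i + 1)\<close> is close to \<open>f\<^sup>i\<^sup>+\<^sup>1 p\<close>, and so is \<open>f (x i)\<close> by uniform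
  continuity of \<open>f\<close>; each of the two distances may use up half of the allowed error.
\<close>

lemma pseudo_orbit_if_near_orbit:
  fixes f :: "'a::metric_space \<Rightarrow> 'a"
  assumes "uniformly_continuous_on UNIV f" "bij f" "0 < \<gamma>"
  obtains \<eta> where "0 < \<eta>"
    "\<And>x p. (\<And>i. dist (x i) (orb f p i) \<le> \<eta>) \<Longrightarrow> x \<in> pseudo_orbits f \<gamma>"
proof -
  obtain d where d: "0 < d" "\<And>u v. dist u v < d \<Longrightarrow> dist (f u) (f v) < \<gamma>/2"
    using assms(1,3) unfolding uniformly_continuous_on_def by (metis UNIV_I half_gt_zero)
  define \<eta> where "\<eta> = min (d/2) (\<gamma>/2)"
  have "x \<in> pseudo_orbits f \<gamma>" if x: "\<And>i. dist (x i) (orb f p i) \<le> \<eta>" for x p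
  proof -
    have "dist (x (i + 1)) (f (x i)) \<le> \<gamma>" for i
    proof -
      have "dist (x i) (orb f p i) < d"
        using x[of i] d(1) by (simp add: \<eta>_def)
      then have "dist (f (x i)) (orb f p (i + 1)) < \<gamma>/2"
        using d(2) by (simp add: orb_def iter_Suc[OF assms(2)])
      moreover have "dist (x (i + 1)) (orb f p (i + 1)) \<le> \<gamma>/2"
        using x[of "i + 1"] by (simp add: \<eta>_def)
      ultimately show ?thesis
        using dist_triangle2[of "x (i + 1)" "f (x i)" "orb f p (i + 1)"] by linarith
    qed
    then show ?thesis
      by (simp add: pseudo_orbits_def)
  qed
  moreover have "0 < \<eta>"
    using d(1) assms(3) by (simp add: \<eta>_def)
  ultimately show ?thesis
    using that by blast
qed

text \<open>
  On the compact space of pseudo-orbits a pseudo-orbit map is uniformly continuous. This is what makes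
  \<open>\<eta>\<close> independent of \<open>p\<close>, so that the estimate can later be used along a whole orbit.
\<close>

lemma pseudo_orbit_map_near:
  fixes f :: "'a::metric_space \<Rightarrow> 'a"
  assumes "compact (UNIV :: 'a set)" "continuous_on UNIV f" "bij f"
    and Sh: "pseudo_orbit_map f \<delta> Sh" and "0 < e"
  obtains \<eta> where "0 < \<eta>"
    "\<And>x p. x \<in> pseudo_orbits f \<delta> \<Longrightarrow> (\<And>i. dist (x i) (orb f p i) \<le> \<eta>) \<Longrightarrow> dist (Sh x) p \<le> e"
proof -
  have "0 < \<delta>" and fix_orb: "\<And>p. Sh (orb f p) = p"
    and cont: "continuous_on (pseudo_orbits f \<delta>) Sh"
    using Sh by (auto simp: pseudo_orbit_map_def)
  have "compact (pseudo_orbits f \<delta>)"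
    using compact_Int_closed[OF compact_UNIV_fun[OF assms(1)] closed_pseudo_orbits[OF assms(2)]] by simp
  then have "uniformly_continuous_on (pseudo_orbits f \<delta>) Sh"
    by (rule compact_uniformly_continuous[OF cont])
  then obtain d where d: "0 < d"
    "\<And>x y. x \<in> pseudo_orbits f \<delta> \<Longrightarrow> y \<in> pseudo_orbits f \<delta> \<Longrightarrow> dist x y < d \<Longrightarrow> dist (Sh x) (Sh y) < e"
    using \<open>0 < e\<close> unfolding uniformly_continuous_on_def by metis
  have "dist (Sh x) p \<le> e"
    if x: "x \<in> pseudo_orbits f \<delta>" "\<And>i. dist (x i) (orb f p i) \<le> d/4" for x p
  proof -
    have "dist x (orb f p) < d"
      using dist_fun_le_uniform[of x "orb f p" "d/4"] x(2) d(1) by simp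
    then show ?thesis
      using d(2)[OF x(1) orb_in_pseudo_orbits[OF assms(3), of \<delta> p]] \<open>0 < \<delta>\<close> by (simp add: fix_orb)
  qed
  then show ?thesis
    using that[of "d/4"] d(1) by simp
qed

section \<open>Expansivity\<close>

lemma diameter_le_if_near_point:
  fixes S :: "'a::metric_space set"
  assumes "\<And>z. z \<in> S \<Longrightarrow> dist z a \<le> r" "0 \<le> r"
  shows "diameter S \<le> 2 * r"
proof -
  have "dist z w \<le> 2 * r" if "z \<in> S" "w \<in> S" for z w
    using assms(1)[OF that(1)] assms(1)[OF that(2)] dist_triangle2[of z w a] by linarith
  then show ?thesis
    using assms(2) unfolding diameter_def by (auto intro!: cSUP_least)
qed

theorem theorem3p3:
  fixes f :: "'a::metric_space \<Rightarrow> 'a"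
  assumes "compact (UNIV :: 'a set)"
    and "\<exists>g. homeomorphism UNIV UNIV f g"
    and "locally connected (UNIV :: 'a set)"
    and "cw_expansive f"
    and "\<exists>\<delta> Sh. shadowing_map f \<delta> Sh"
  shows "expansive f"
proof -
  obtain g where hom: "homeomorphism UNIV UNIV f g"
    using assms(2) by blast
  have contf: "continuous_on UNIV f"
    using hom by (simp add: homeomorphism_def)
  have bijf: "bij f"
    using hom by (intro bij_betw_byWitness[where f' = g]) (auto simp: homeomorphism_def)
  have ucf: "uniformly_continuous_on UNIV f"
    by (rule compact_uniformly_continuous[OF contf assms(1)])
  obtain \<xi> where "0 < \<xi>"
    and cw: "\<And>C. continuum C \<Longrightarrow> (\<And>i. diameter (iter f i ` C) \<le> \<xi>) \<Longrightarrow> is_singleton C"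
    using assms(4) unfolding cw_expansive_def by blast
  obtain \<delta> Sh where sh: "shadowing_map f \<delta> Sh"
    using assms(5) by blast
  then have Sh: "pseudo_orbit_map f \<delta> Sh"
    by (simp add: shadowing_map_def)
  then have fix_orb: "\<And>p. Sh (orb f p) = p"
    and contSh: "continuous_on (pseudo_orbits f \<delta>) Sh"
    by (auto simp: pseudo_orbit_map_def)
  \<comment> \<open>The distance from \<open>f\<^sup>i (Sh x)\<close> to \<open>f\<^sup>i p\<close> is at most the sum of a shadowing error and a continuity
    error. With \<open>\<xi>/4\<close> for each, the distance is at most \<open>\<xi>/2\<close> and the diameter at most \<open>\<xi>\<close>.\<close>
  have "0 < \<xi>/4" using \<open>0 < \<xi>\<close> by simp
  then obtain \<gamma> where "0 < \<gamma>" "\<gamma> \<le> \<delta>" and shadow: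
    "\<And>x i. x \<in> pseudo_orbits f \<gamma> \<Longrightarrow> dist (iter f i (Sh x)) (Sh (iter shift i x)) \<le> \<xi>/4"
    using sh unfolding shadowing_map_def by blast
  obtain \<eta>1 where "0 < \<eta>1"
    and near_pseudo: "\<And>x p. (\<And>i. dist (x i) (orb f p i) \<le> \<eta>1) \<Longrightarrow> x \<in> pseudo_orbits f \<gamma>"
    using pseudo_orbit_if_near_orbit[OF ucf bijf \<open>0 < \<gamma>\<close>] by blast
  obtain \<eta>2 where "0 < \<eta>2" and near_Sh:
    "\<And>x p. x \<in> pseudo_orbits f \<delta> \<Longrightarrow> (\<And>i. dist (x i) (orb f p i) \<le> \<eta>2) \<Longrightarrow> dist (Sh x) p \<le> \<xi>/4"
    using pseudo_orbit_map_near[OF assms(1) contf bijf Sh \<open>0 < \<xi>/4\<close>] by blast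
  have "0 < min \<eta>1 \<eta>2" using \<open>0 < \<eta>1\<close> \<open>0 < \<eta>2\<close> by simp
  then obtain d where "0 < d" and ulc: "\<And>p q :: 'a. dist p q < d \<Longrightarrow>
      \<exists>C. connected C \<and> p \<in> C \<and> q \<in> C \<and> (\<forall>z\<in>C. dist z p \<le> min \<eta>1 \<eta>2)"
    using uniformly_locally_connected[OF assms(1,3)] by metis
  have "p = q" if close: "\<And>i. dist (iter f i p) (iter f i q) \<le> d/2" for p q
  proof -
    have "\<exists>C. connected C \<and> orb f p i \<in> C \<and> orb f q i \<in> C \<and> (\<forall>z\<in>C. dist z (orb f p i) \<le> min \<eta>1 \<eta>2)"
      for i
      using close[of i] \<open>0 < d\<close> by (intro ulc) (simp add: orb_def)
    then obtain C where conn: "\<And>i. connected (C i)"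
      and pC: "\<And>i. orb f p i \<in> C i" and qC: "\<And>i. orb f q i \<in> C i"
      and C_near: "\<And>i z. z \<in> C i \<Longrightarrow> dist z (orb f p i) \<le> min \<eta>1 \<eta>2"
      by metis
    define K where "K = Pi UNIV C"
    have K_near: "dist (x i) (orb f p i) \<le> min \<eta>1 \<eta>2" if "x \<in> K" for x i
      using that C_near unfolding K_def by auto
    have K_pseudo: "x \<in> pseudo_orbits f \<gamma>" if "x \<in> K" for x
      using K_near[OF that] by (intro near_pseudo[of x p]) auto
    have K_sub: "K \<subseteq> pseudo_orbits f \<delta>"
      using K_pseudo pseudo_orbits_mono[OF \<open>\<gamma> \<le> \<delta>\<close>] by blast
    have iter_near: "dist (iter f i (Sh x)) (iter f i p) \<le> \<xi>/2" if "x \<in> K" for x i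
    proof -
      have "iter shift i x \<in> pseudo_orbits f \<delta>"
        using that K_sub by (blast intro: iter_shift_pseudo_orbits)
      then have "dist (Sh (iter shift i x)) (iter f i p) \<le> \<xi>/4"
        using K_near[OF that] by (intro near_Sh) (auto simp: iter_shift orb_iter[OF bijf])
      moreover have "dist (iter f i (Sh x)) (Sh (iter shift i x)) \<le> \<xi>/4"
        by (rule shadow[OF K_pseudo[OF that]])
      ultimately show ?thesis
        using dist_triangle[of "iter f i (Sh x)" "iter f i p" "Sh (iter shift i x)"] by linarith
    qed
    define D where "D = closure (Sh ` K)"
    have D_near: "dist (iter f i z) (iter f i p) \<le> \<xi>/2" if "z \<in> D" for z i
    proof -
      have "closed {z. dist (iter f i z) (iter f i p) \<le> \<xi>/2}"
        by (intro closed_Collect_le continuous_intros continuous_on_iter[OF hom])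
      then have "D \<subseteq> {z. dist (iter f i z) (iter f i p) \<le> \<xi>/2}"
        unfolding D_def using iter_near by (intro closure_minimal) auto
      then show ?thesis using that by blast
    qed
    have "orb f p \<in> K" "orb f q \<in> K"
      using pC qC by (auto simp: K_def)
    then have "Sh (orb f p) \<in> D" "Sh (orb f q) \<in> D"
      unfolding D_def using closure_subset[of "Sh ` K"] by auto
    then have pD: "p \<in> D" and qD: "q \<in> D"
      by (simp_all add: fix_orb)
    have "connected (Sh ` K)"
      using continuous_on_subset[OF contSh K_sub] connected_Pi_UNIV[of C] conn
      unfolding K_def by (blast intro: connected_continuous_image)
    then have "continuum D"
      using pD unfolding continuum_def D_def by (auto intro: connected_imp_connected_closure)
    moreover have "diameter (iter f i ` D) \<le> \<xi>" for i
      using diameter_le_if_near_point[of "iter f i ` D" "iter f i p" "\<xi>/2"] D_near \<open>0 < \<xi>\<close> by auto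
    ultimately have "is_singleton D"
      by (rule cw)
    then show "p = q"
      using pD qD by (auto simp: is_singleton_def)
  qed
  then show ?thesis
    unfolding expansive_def using \<open>0 < d\<close> by (intro exI[of _ "d/2"]) (force simp: not_less)
qed

end
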